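(* Let $n \geq 1$, let $S$ be a semifield and let $T\colon M_n(S) \to M_n(S)$ be a bijective linear map. The following are equivalent: (i) $T$ preserves $\mathcal{L}$; (ii) $T$ preserves $\mathcal{R}$; (iii) $T$ preserves $\leq_{\mathcal{L}}$; (iv) $T$ preserves $\leq_{\mathcal{R}}$; (v) there exist $P, Q \in GL_n(S)$ such that $T(A) = PAQ$ for all $A \in M_n(S)$.
   Context: A semifield is a set $S$ with two associative commutative binary operations $+$ and $\times$ such that $\times$ distributes over $+$, there is an element $0$ which is an identity for $+$ and a zero element for $\times$, and $S \setminus \{0\}$ is a group under $\times$ with identity denoted $1$ (so every field is a semifield; additive inverses need not exist). $M_n(S)$ is the set of $n \times n$ matrices over $S$, viewed both as an $S$-module (entrywise addition and scaling) and as a monoid under matrix multiplication; $GL_n(S)$ is the group of multiplicatively invertible elements of $M_n(S)$. A map $T$ on $M_n(S)$ is linear if $T(A+B)=T(A)+T(B)$ and $T(sA)=sT(A)$ for all $A,B \in M_n(S)$, $s \in S$. Green's relations on $M_n(S)$: $A \leq_{\mathcal{L}} B$ if $A = XB$ for some $X \in M_n(S)$; $A \leq_{\mathcal{R}} B$ if $A = BX$ for some $X \in M_n(S)$; $A\,\mathcal{L}\,B$ if $A \leq_{\mathcal{L}} B$ and $B \leq_{\mathcal{L}} A$; $A\,\mathcal{R}\,B$ if $A \leq_{\mathcal{R}} B$ and $B \leq_{\mathcal{R}} A$. A map $T$ preserves a binary relation $\equiv$ on $M_n(S)$ if $A \equiv B$ implies $T(A) \equiv T(B)$ for all $A,B \in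 M_n(S)$. *)

theory Defs
  imports "HOL-Analysis.Analysis"
begin

(* The group of nonzero elements is rendered by existence of inverses alone: 1 \<noteq> 0 is part of
   comm_semiring_1, and closure of the nonzero elements under multiplication follows. *)
class semifield = comm_semiring_1 +
  assumes ex_mult_inverse: "a \<noteq> 0 \<Longrightarrow> \<exists>b. a * b = 1"

definition matrix_scale :: "'a::semifield \<Rightarrow> 'a^'n^'n \<Rightarrow> 'a^'n^'n" where
  "matrix_scale s A = (\<chi> i j. s * A $ i $ j)"

(* The library's linear and module_hom need additive inverses. *)
definition matrix_linear :: "('a::semifield^'n^'n \<Rightarrow> 'a^'n^'n) \<Rightarrow> bool" where
  "matrix_linear T \<longleftrightarrow>
     (\<forall>A B. T (A + B) = T A + T B) \<and> (\<forall>s A. T (matrix_scale s A) = matrix_scale s (T A))"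

definition GL :: "('a::semifield^'n^'n) set" where
  "GL = {P. invertible P}"

definition leq_L :: "'a::semifield^'n^'n \<Rightarrow> 'a^'n^'n \<Rightarrow> bool" where
  "leq_L A B \<longleftrightarrow> (\<exists>X :: 'a^'n^'n. A = X ** B)"

definition leq_R :: "'a::semifield^'n^'n \<Rightarrow> 'a^'n^'n \<Rightarrow> bool" where
  "leq_R A B \<longleftrightarrow> (\<exists>X :: 'a^'n^'n. A = B ** X)"

definition green_L :: "'a::semifield^'n^'n \<Rightarrow> 'a^'n^'n \<Rightarrow> bool" where
  "green_L A B \<longleftrightarrow> leq_L A B \<and> leq_L B A"

definition green_R :: "'a::semifield^'n^'n \<Rightarrow> 'a^'n^'n \<Rightarrow> bool" where
  "green_R A B \<longleftrightarrow> leq_R A B \<and> leq_R B A"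

definition preserves :: "('m \<Rightarrow> 'm) \<Rightarrow> ('m \<Rightarrow> 'm \<Rightarrow> bool) \<Rightarrow> bool" where
  "preserves T r \<longleftrightarrow> (\<forall>A B. r A B \<longrightarrow> r (T A) (T B))"

end

theory Submission
  imports Defs
begin

text \<open>
  A semifield is either antinegative (\<open>x + y = 0\<close> forces \<open>x = 0\<close>) or a field. In both cases the
  matrices \<open>u v\<^sup>T\<close> with fixed \<open>v\<close> and arbitrary \<open>u \<noteq> 0\<close> are all \<open>\<L>\<close>-related.

  In the antinegative case a bijective linear map permutes the matrix units up to scalars. Preserving
  the classes of the matrices \<open>u v\<^sup>T\<close> forces the permutation to act on rows and columns separately and
  the scalars to form a rank one matrix.

  In the field case fix \<open>w \<noteq> 0\<close> and consider \<open>A \<mapsto> T(A) w\<close>. It does not vanish on invertible matrices,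
  and it is the sum of maps \<open>G\<^sub>j\<close> applied to the columns of \<open>A\<close>, each of which is zero or invertible.
  If \<open>G\<^sub>a\<^sup>-\<^sup>1 G\<^sub>b\<close> had no eigenvector, then some invertible matrix would be annihilated; so all \<open>G\<^sub>j\<close>
  are proportional and \<open>T(A) w = P\<^sub>w A l\<^sub>w\<close>. Additivity in \<open>w\<close> makes the \<open>P\<^sub>w\<close> proportional as well, whence
  \<open>T(A) = P A Q\<close>.
\<close>

subsection \<open>Matrices over semifields\<close>

lemma semifield_mult_eq_0:
  fixes a b :: "'a::semifield"
  shows "a * b = 0 \<longleftrightarrow> a = 0 \<or> b = 0"
proof -
  have "b = 0" if ab: "a * b = 0" and "a \<noteq> 0"
  proof -
    obtain c where "a * c = 1" using ex_mult_inverse \<open>a \<noteq> 0\<close> by blast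
    then have "b = c * (a * b)" by (metis mult.assoc mult.commute mult_1)
    then show ?thesis by (simp add: ab)
  qed
  then show ?thesis by auto
qed

section \<open>Rank one matrices and matrix units\<close>

definition outer :: "'a::times^'m \<Rightarrow> 'a^'n \<Rightarrow> 'a^'n^'m" where
  "outer u v = (\<chi> i j. u $ i * v $ j)"

lemma outer_nth [simp]: "outer u v $ i $ j = u $ i * v $ j"
  by (simp add: outer_def)

abbreviation matrix_unit :: "'m \<Rightarrow> 'n \<Rightarrow> 'a::semiring_1^'n^'m" where
  "matrix_unit i j \<equiv> outer (axis i 1) (axis j 1)"

lemma outer_add_left: "outer (u + u') v = outer u v + outer u' (v :: 'a::semiring^'n)"
  by (simp add: vec_eq_iff distrib_right)

lemma outer_add_right: "outer u (v + v') = outer u v + outer u (v' :: 'a::semiring^'n)"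
  by (simp add: vec_eq_iff distrib_left)

lemma outer_scale_left: "outer (s *s u) v = matrix_scale s (outer u (v :: 'a::semifield^'n))"
  by (simp add: vec_eq_iff matrix_scale_def mult.assoc)

lemma outer_scale_right: "outer u (s *s v) = matrix_scale s (outer u (v :: 'a::semifield^'n))"
  by (simp add: vec_eq_iff matrix_scale_def ac_simps)

lemma matrix_mult_outer: "X ** outer u v = outer (X *v u) (v :: 'a::comm_semiring_1^'n)"
  by (simp add: vec_eq_iff matrix_matrix_mult_def matrix_vector_mult_def sum_distrib_left
      sum_distrib_right ac_simps)

lemma outer_matrix_mult: "outer u v ** X = outer u (v v* (X :: 'a::comm_semiring_1^'n^'n))"
  by (simp add: vec_eq_iff matrix_matrix_mult_def vector_matrix_mult_def sum_distrib_left ac_simps)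

lemma sum_axis_mult:
  fixes f :: "'n::finite \<Rightarrow> 'a::comm_semiring_1"
  shows "(\<Sum>i\<in>UNIV. axis k c $ i * f i) = c * f k"
proof -
  have "(\<Sum>i\<in>UNIV. axis k c $ i * f i) = (\<Sum>i\<in>UNIV. if i = k then c * f i else 0)"
    by (intro sum.cong) (auto simp: axis_def)
  then show ?thesis by simp
qed

lemma matrix_sum_columns:
  fixes A :: "'a::comm_semiring_1^'n^'m"
  shows "A = (\<Sum>j\<in>UNIV. outer (column j A) (axis j 1))"
  by (simp add: vec_eq_iff column_def mult.commute[of "A $ _ $ _"] axis_def of_bool_def
      if_distrib[of "\<lambda>x. x * _"] cong: if_cong)

lemma matrix_sum_units:
  fixes A :: "'a::semifield^'n^'n"
  shows "A = (\<Sum>i\<in>UNIV. \<Sum>j\<in>UNIV. matrix_scale (A $ i $ j) (matrix_unit i j))"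
proof -
  have "(\<Sum>i\<in>UNIV. \<Sum>j\<in>UNIV. matrix_scale (A $ i $ j) (matrix_unit i j)) $ k $ l = A $ k $ l" for k l
  proof -
    have "(\<Sum>i\<in>UNIV. \<Sum>j\<in>UNIV. matrix_scale (A $ i $ j) (matrix_unit i j)) $ k $ l
        = (\<Sum>i\<in>UNIV. \<Sum>j\<in>UNIV. axis k 1 $ i * (axis l 1 $ j * A $ i $ j))"
      by (simp add: matrix_scale_def axis_def) (intro sum.cong refl, auto)
    then show ?thesis
      by (simp add: sum_axis_mult flip: sum_distrib_left)
  qed
  then show ?thesis by (simp add: vec_eq_iff)
qed

section \<open>Linear maps on matrices\<close>

lemma matrix_linear_add: "matrix_linear T \<Longrightarrow> T (A + B) = T A + T B"
  and matrix_linear_scale: "matrix_linear T \<Longrightarrow> T (matrix_scale s A) = matrix_scale s (T A)"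
  by (auto simp: matrix_linear_def)

lemma matrix_scale_0 [simp]: "matrix_scale 0 A = 0"
  by (simp add: vec_eq_iff matrix_scale_def)

lemma matrix_scale_1 [simp]: "matrix_scale 1 A = A"
  by (simp add: vec_eq_iff matrix_scale_def)

lemma matrix_scale_scale: "matrix_scale s (matrix_scale t A) = matrix_scale (s * t) A"
  by (simp add: vec_eq_iff matrix_scale_def mult.assoc)

lemma matrix_mult_scale_right: "A ** matrix_scale s B = matrix_scale s (A ** B)"
  by (simp add: vec_eq_iff matrix_scale_def matrix_matrix_mult_def sum_distrib_left ac_simps)

lemma matrix_mult_scale_left: "matrix_scale s A ** B = matrix_scale s (A ** B)"
  by (simp add: vec_eq_iff matrix_scale_def matrix_matrix_mult_def sum_distrib_left ac_simps)

lemma matrix_mult_add_rdistrib: "(A + B) ** C = A ** C + B ** (C :: 'a::semiring_1^'n^'m)"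
  by (simp add: vec_eq_iff matrix_matrix_mult_def distrib_right sum.distrib)

lemma matrix_scale_mult_vec: "matrix_scale s A *v x = s *s (A *v x)"
  by (simp add: vec_eq_iff matrix_scale_def matrix_vector_mult_def sum_distrib_left ac_simps)

lemma matrix_linear_0: "matrix_linear T \<Longrightarrow> T 0 = 0"
  by (metis matrix_linear_scale matrix_scale_0)

lemma matrix_linear_sum: "matrix_linear T \<Longrightarrow> T (\<Sum>i\<in>I. f i) = (\<Sum>i\<in>I. T (f i))"
  by (induction I rule: infinite_finite_induct) (simp_all add: matrix_linear_0 matrix_linear_add)

lemma matrix_linear_eqI:
  assumes "matrix_linear T" "matrix_linear T'" "\<And>i j. T (matrix_unit i j) = T' (matrix_unit i j)"
  shows "T A = T' A"
proof -
  have "F A = (\<Sum>i\<in>UNIV. \<Sum>j\<in>UNIV. matrix_scale (A $ i $ j) (F (matrix_unit i j)))"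
    if "matrix_linear F" for F
    by (subst matrix_sum_units[of A]) (simp add: matrix_linear_sum[OF that] matrix_linear_scale[OF that])
  from this[OF assms(1)] this[OF assms(2)] show ?thesis by (simp add: assms(3))
qed

lemma matrix_linear_mult: "matrix_linear (\<lambda>A. P ** A ** Q)"
  by (simp add: matrix_linear_def matrix_add_ldistrib matrix_mult_add_rdistrib
      matrix_mult_scale_left matrix_mult_scale_right)

lemma matrix_linear_inv:
  assumes "bij T" "matrix_linear T"
  shows "matrix_linear (inv T)"
proof -
  have T_inv: "T (inv T A) = A" and inv_T: "inv T (T A) = A" for A
    using \<open>bij T\<close> by (simp_all add: bij_def surj_f_inv_f)
  have "inv T (A + B) = inv T (T (inv T A + inv T B))" for A B
    by (simp add: matrix_linear_add[OF assms(2)] T_inv)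
  moreover have "inv T (matrix_scale s A) = inv T (T (matrix_scale s (inv T A)))" for s A
    by (simp add: matrix_linear_scale[OF assms(2)] T_inv)
  ultimately show ?thesis by (simp add: matrix_linear_def inv_T)
qed

text \<open>If \<open>P ** Y = mat 1\<close> then \<open>T (Y ** P) = T (mat 1)\<close>, so injectivity of \<open>T\<close> makes the one-sided inverse
  two-sided; over a semifield no determinant or dimension argument is available.\<close>

lemma bij_mult_imp_GL:
  fixes P Q :: "'a::semifield^'n^'n"
  assumes bij: "bij T" and T: "\<And>A. T A = P ** A ** Q"
  shows "P \<in> GL \<and> Q \<in> GL"
proof -
  obtain A where A: "P ** A ** Q = mat 1" by (metis T bij bij_pointE)
  have inj: "B = C" if "P ** B ** Q = P ** C ** Q" for B C
    using that bij T by (metis bij_def injD)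
  have PX: "P ** (A ** Q) = mat 1" and XQ: "(P ** A) ** Q = mat 1"
    using A by (simp_all add: matrix_mul_assoc)
  have "A ** Q ** P = mat 1"
  proof (rule inj)
    show "P ** (A ** Q ** P) ** Q = P ** mat 1 ** Q"
      by (metis PX matrix_mul_assoc matrix_mul_lid matrix_mul_rid)
  qed
  moreover have "Q ** (P ** A) = mat 1"
  proof (rule inj)
    show "P ** (Q ** (P ** A)) ** Q = P ** mat 1 ** Q"
      by (metis XQ matrix_mul_assoc matrix_mul_rid)
  qed
  ultimately show ?thesis
    using PX XQ unfolding GL_def invertible_def by blast
qed

text \<open>If c inverts a nonzero entry u'_p, then left multiplication by u (c e_p)^T carries u' to
  u, hence u' v^T to u v^T.\<close>

lemma green_L_outer:
  fixes v :: "'a::semifield^'n"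
  assumes "u \<noteq> 0" "u' \<noteq> 0"
  shows "green_L (outer u v) (outer u' v)"
proof -
  have "leq_L (outer u v) (outer u' v)" if "u' \<noteq> 0" for u u' :: "'a^'n"
  proof -
    obtain p where "u' $ p \<noteq> 0" using \<open>u' \<noteq> 0\<close> by (auto simp: vec_eq_iff)
    then obtain c where c: "u' $ p * c = 1" using ex_mult_inverse by blast
    have "outer u (axis p c) *v u' = u"
      using c by (simp add: vec_eq_iff matrix_vector_mult_def mult.assoc sum_axis_mult
          mult.commute[of c] flip: sum_distrib_left)
    then have "outer u v = outer u (axis p c) ** outer u' v"
      by (simp add: matrix_mult_outer)
    then show ?thesis unfolding leq_L_def by blast
  qed
  then show ?thesis using assms by (simp add: green_L_def)
qed

text \<open>The form in which preservation enters both the antinegative and the field case: the rows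
  of \<open>T A\<close> are linear combinations of the rows of \<open>T B\<close>.\<close>

lemma preserves_green_L:
  assumes "preserves T green_L" "green_L A B"
  obtains X where "T A = X ** T B"
  using assms by (auto simp: preserves_def green_L_def leq_L_def)

subsection \<open>Antinegative semifields\<close>

lemma sum_eq_0_imp_eq_0:
  fixes f :: "'b \<Rightarrow> 'a::comm_monoid_add"
  assumes zsf: "\<And>x y :: 'a. x + y = 0 \<Longrightarrow> x = 0" and "finite I" "sum f I = 0" "i \<in> I"
  shows "f i = 0"
  using assms(2-4) by (metis zsf sum.remove)

lemma matrix_unit_neq_0: "matrix_unit i j \<noteq> (0 :: 'a::semiring_1^'n^'m)"
proof
  assume "matrix_unit i j = (0 :: 'a^'n^'m)"
  then have "matrix_unit i j $ i $ j = (0 :: 'a^'n^'m) $ i $ j" by simp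
  then show False by (simp add: axis_def)
qed

text \<open>Let B = T(E_ij). Applying the inverse R of T writes E_ij as the sum of B_kl R(E_kl).
  Nothing can cancel, so R(E_kl) is a multiple d E_ij whenever B_kl is nonzero. One such pair gives
  E_kl = d B, and d is invertible.\<close>

lemma antinegative_monomial:
  fixes T :: "'a::semifield^'n^'n \<Rightarrow> 'a^'n^'n"
  assumes zsf: "\<And>x y :: 'a. x + y = 0 \<Longrightarrow> x = 0" and bij: "bij T" and lin: "matrix_linear T"
  shows "\<exists>k l c. c \<noteq> 0 \<and> T (matrix_unit i j) = matrix_scale c (matrix_unit k l)"
proof -
  have inj: "inj T" and surj: "surj T" using bij by (auto simp: bij_def)
  define R where "R = inv T"
  have linR: "matrix_linear R" using matrix_linear_inv[OF bij lin] by (simp add: R_def)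
  have TR: "T (R A) = A" and RT: "R (T A) = A" for A
    using inj surj by (simp_all add: R_def surj_f_inv_f)
  define B where "B = T (matrix_unit i j)"
  have RB: "matrix_unit i j = (\<Sum>k\<in>UNIV. \<Sum>l\<in>UNIV. matrix_scale (B $ k $ l) (R (matrix_unit k l)))"
  proof -
    have "R B = (\<Sum>k\<in>UNIV. \<Sum>l\<in>UNIV. matrix_scale (B $ k $ l) (R (matrix_unit k l)))"
      by (subst matrix_sum_units[of B]) (simp add: matrix_linear_sum[OF linR] matrix_linear_scale[OF linR])
    then show ?thesis by (simp add: B_def RT)
  qed
  \<comment> \<open>Away from position (i, j) the summands add up to 0, so antinegativity makes each
    of them 0.\<close>
  have R_support: "R (matrix_unit k l) = matrix_scale (R (matrix_unit k l) $ i $ j) (matrix_unit i j)" if "B $ k $ l \<noteq> 0" for k l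
  proof -
    have "R (matrix_unit k l) $ p $ q = 0" if "(p, q) \<noteq> (i, j)" for p q
    proof -
      have "(\<Sum>k\<in>UNIV. \<Sum>l\<in>UNIV. B $ k $ l * R (matrix_unit k l) $ p $ q) = matrix_unit i j $ p $ q"
        by (subst RB) (simp add: matrix_scale_def)
      also have "\<dots> = 0" using that by (auto simp: axis_def)
      finally have "B $ k $ l * R (matrix_unit k l) $ p $ q = 0"
        using zsf by (metis (no_types, lifting) UNIV_I finite sum_eq_0_imp_eq_0)
      then show ?thesis using \<open>B $ k $ l \<noteq> 0\<close> by (simp add: semifield_mult_eq_0)
    qed
    then show ?thesis by (auto simp: vec_eq_iff matrix_scale_def axis_def)
  qed
  have "B \<noteq> 0"
  proof
    assume "B = 0"
    then have "matrix_unit i j = (0 :: 'a^'n^'n)" using RT linR by (metis B_def matrix_linear_0)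
    then show False by (simp add: matrix_unit_neq_0)
  qed
  then obtain k l where kl: "B $ k $ l \<noteq> 0" by (auto simp: vec_eq_iff)
  define d where "d = R (matrix_unit k l) $ i $ j"
  have Rkl: "R (matrix_unit k l) = matrix_scale d (matrix_unit i j)"
    using R_support[OF kl] by (simp add: d_def)
  then have unit_kl: "matrix_unit k l = matrix_scale d B"
    by (metis B_def TR lin matrix_linear_scale)
  have "d \<noteq> 0" using unit_kl by (metis matrix_scale_0 matrix_unit_neq_0)
  then obtain c where c: "d * c = 1" using ex_mult_inverse by blast
  have "B = matrix_scale c (matrix_unit k l)"
    by (simp add: unit_kl matrix_scale_scale mult.commute[of c] c)
  moreover have "c \<noteq> 0" using c by auto
  ultimately show ?thesis by (auto simp: B_def)
qed

lemma outer_axis_sum: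
  fixes u :: "'a::semifield^'n"
  shows "outer u (axis j 1) = (\<Sum>i\<in>UNIV. matrix_scale (u $ i) (matrix_unit i j))"
proof -
  have "(\<Sum>i\<in>UNIV. matrix_scale (u $ i) (matrix_unit i j)) $ p $ q = outer u (axis j 1) $ p $ q" for p q
  proof -
    have "(\<Sum>i\<in>UNIV. matrix_scale (u $ i) (matrix_unit i j)) $ p $ q
      = (\<Sum>i\<in>UNIV. if i = p then u $ p * axis j 1 $ q else 0)"
      unfolding sum_component by (intro sum.cong) (auto simp: matrix_scale_def axis_def)
    then show ?thesis by simp
  qed
  then show ?thesis by (simp add: vec_eq_iff)
qed

lemma matrix_vector_mult_axis: "A *v axis i 1 = column i (A :: 'a::comm_semiring_1^'n^'m)"
proof -
  have "(A *v axis i 1) $ p = (\<Sum>j\<in>UNIV. axis i 1 $ j * A $ p $ j)" for p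
    unfolding matrix_vector_mult_def by (simp add: mult.commute)
  then show ?thesis by (simp add: vec_eq_iff column_def sum_axis_mult)
qed

lemma axis_vector_matrix_mult: "axis i 1 v* A = row i (A :: 'a::comm_semiring_1^'n^'m)"
proof -
  have "(axis i 1 v* A) $ p = (\<Sum>j\<in>UNIV. axis i 1 $ j * A $ j $ p)" for p
    unfolding vector_matrix_mult_def by (simp add: mult.commute)
  then show ?thesis by (simp add: vec_eq_iff row_def sum_axis_mult)
qed

text \<open>Write T(E_ij) = c_ij E_kl with k = f(i,j) and l = g(i,j). Comparing images of matrices u
  v^T with the same v shows, for v = e_j, that g depends on j alone, and, for v = e_j + e_k, that f
  depends on i alone and that c has rank one. The monomial matrices P and Q are read off from
  this.\<close>

lemma antinegative_preserver:
  fixes T :: "'a::semifield^'n^'n \<Rightarrow> 'a^'n^'n"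
  assumes zsf: "\<And>x y :: 'a. x + y = 0 \<Longrightarrow> x = 0" and bij: "bij T" and lin: "matrix_linear T"
    and pres: "preserves T green_L"
  shows "\<exists>P Q. \<forall>A. T A = P ** A ** Q"
proof -
  have "\<forall>i j. \<exists>k l c. c \<noteq> 0 \<and> T (matrix_unit i j) = matrix_scale c (matrix_unit k l)"
    using antinegative_monomial[OF zsf bij lin] by simp
  then obtain f g :: "'n \<Rightarrow> 'n \<Rightarrow> 'n" and c :: "'n \<Rightarrow> 'n \<Rightarrow> 'a" where c0: "\<And>i j. c i j \<noteq> 0"
    and Tu: "\<And>i j. T (matrix_unit i j) = matrix_scale (c i j) (matrix_unit (f i j) (g i j))"
    unfolding choice_iff by blast
  have Tu_nth: "T (matrix_unit i j) $ p $ q = (if p = f i j \<and> q = g i j then c i j else 0)" for i j p q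
    unfolding Tu by (auto simp: matrix_scale_def axis_def)
  have inj: "i = i' \<and> j = j'" if "f i j = f i' j'" "g i j = g i' j'" for i j i' j'
  proof -
    obtain d where "c i' j' * d = 1" using c0 ex_mult_inverse by blast
    then have "T (matrix_unit i j) = matrix_scale (c i j * d) (T (matrix_unit i' j'))"
      using that by (simp add: Tu matrix_scale_scale mult.assoc mult.commute[of d])
    then have "T (matrix_unit i j) = T (matrix_scale (c i j * d) (matrix_unit i' j'))"
      by (simp add: matrix_linear_scale[OF lin])
    then have "matrix_unit i j = matrix_scale (c i j * d) (matrix_unit i' j')"
      using bij by (metis bij_def injD)
    then have "matrix_unit i j $ i $ j = matrix_scale (c i j * d) (matrix_unit i' j') $ i $ j" by simp
    then show ?thesis by (auto simp: matrix_scale_def axis_def split: if_splits)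
  qed
  \<comment> \<open>Left multiplication keeps zero columns zero, and each of the two images has a
    single nonzero column.\<close>
  have g_col: "g i j = g i' j" for i i' j
  proof -
    have "green_L (matrix_unit i j) (matrix_unit i' j :: 'a^'n^'n)" by (simp add: green_L_outer)
    then obtain X where "T (matrix_unit i j) = X ** T (matrix_unit i' j)"
      using preserves_green_L[OF pres] by blast
    then have "T (matrix_unit i j) $ f i j $ g i j = (\<Sum>m\<in>UNIV. X $ f i j $ m * T (matrix_unit i' j) $ m $ g i j)"
      by (simp add: matrix_matrix_mult_def)
    moreover have "T (matrix_unit i j) $ f i j $ g i j \<noteq> 0" using c0 by (simp add: Tu_nth)
    ultimately show ?thesis by (cases "g i j = g i' j") (auto simp: Tu_nth)
  qed
  define z where "z = (undefined :: 'n)"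
  define \<tau> where "\<tau> j = g z j" for j
  have g: "g i j = \<tau> j" for i j using g_col by (simp add: \<tau>_def)
  \<comment> \<open>For fixed j the column of the image is fixed, so distinct i must give distinct
    rows; finiteness turns this into surjectivity.\<close>
  have surj_f: "\<exists>i. f i j = r" for j r
  proof -
    have "inj (\<lambda>i. f i j)"
    proof (rule injI)
      show "i = i'" if "f i j = f i' j" for i i'
        using inj[of i j i' j] g_col[of i j i'] that by blast
    qed
    then have "surj (\<lambda>i. f i j)" by (simp add: finite_UNIV_inj_surj)
    then show ?thesis by (metis surjD)
  qed
  \<comment> \<open>Two source columns with the same target column would have to share positions in
    it, since each of them fills it.\<close>
  have inj_\<tau>: "j = k" if "\<tau> j = \<tau> k" for j k
  proof -
    obtain i where "f i j = f undefined k" using surj_f by blast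
    then show ?thesis using inj[of i j undefined k] that by (simp add: g)
  qed
  have pair_L: "\<exists>X. T (outer u (axis j 1 + axis k 1)) = X ** T (outer u' (axis j 1 + axis k 1))"
    if "u \<noteq> 0" "u' \<noteq> 0" for u u' :: "'a^'n" and j k
    using preserves_green_L[OF pres green_L_outer[OF that]] by blast
  \<comment> \<open>Among the units of column j, only the one in row m is sent to row
    \<open>f m j\<close>.\<close>
  have T_outer: "T (outer u (axis j 1)) $ f m j $ q = (if q = \<tau> j then u $ m * c m j else 0)" for u j m q
  proof -
    have "T (outer u (axis j 1)) = (\<Sum>i\<in>UNIV. matrix_scale (u $ i) (T (matrix_unit i j)))"
      unfolding outer_axis_sum[of u] by (simp add: matrix_linear_sum[OF lin] matrix_linear_scale[OF lin])
    then have "T (outer u (axis j 1)) $ f m j $ q = (\<Sum>i\<in>UNIV. u $ i * T (matrix_unit i j) $ f m j $ q)"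
      by (simp add: matrix_scale_def)
    also have "\<dots> = (\<Sum>i\<in>UNIV. if i = m then (if q = \<tau> j then u $ m * c m j else 0) else 0)"
      using inj[of _ j m j] by (intro sum.cong) (auto simp: Tu_nth g)
    finally show ?thesis by simp
  qed
  have T_pair: "T (outer u (axis j 1 + axis k 1)) = T (outer u (axis j 1)) + T (outer u (axis k 1))" for u j k
    by (simp add: outer_add_right matrix_linear_add[OF lin])
  text \<open>If rows \<open>f i j\<close> and \<open>f i k\<close> differed, then \<open>e\<^sub>i (e\<^sub>j + e\<^sub>k)\<^sup>T\<close> would have an image with a row that is
    nonzero in column \<open>\<tau> j\<close> and zero in column \<open>\<tau> k\<close>. The image \<open>A\<close> of the \<open>\<L>\<close>-related matrix with all
    rows equal to \<open>e\<^sub>j + e\<^sub>k\<close> has no zero in these columns, so by antinegativity no combination of its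
    rows looks like that.\<close>
  have f_row: "f i j = f i k" for i j k
  proof (rule ccontr)
    assume ne: "f i j \<noteq> f i k"
    then have "j \<noteq> k" by auto
    then have \<tau>: "\<tau> j \<noteq> \<tau> k" using inj_\<tau> by blast
    \<comment> \<open>The unit of column k that lands in row \<open>f i j\<close> sits in row i',
      which differs from i by \<open>ne\<close>. Hence e_i (e_j + e_k)^T contributes nothing there
      from column k.\<close>
    obtain i' where i': "f i' k = f i j" using surj_f by blast
    then have ax: "axis i 1 $ i' = (0 :: 'a)" using ne by (auto simp: axis_def)
    define A where "A = T (outer 1 (axis j 1 + axis k 1))"
    have full: "A $ p $ \<tau> j \<noteq> 0 \<and> A $ p $ \<tau> k \<noteq> 0" for p
    proof -
      obtain m m' where "p = f m j" "p = f m' k" using surj_f by metis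
      then show ?thesis
        using \<tau> c0 T_outer[of 1 j m] T_outer[of 1 k m'] by (simp add: A_def T_pair)
    qed
    obtain X where X: "T (outer (axis i 1) (axis j 1 + axis k 1)) = X ** A"
      unfolding A_def using pair_L[of "axis i 1" 1 j k]
      by (metis axis_eq_0_iff one_index zero_index zero_neq_one)
    have row: "(X ** A) $ f i j $ q = (\<Sum>m\<in>UNIV. X $ f i j $ m * A $ m $ q)" for q
      by (simp add: matrix_matrix_mult_def)
    have "(X ** A) $ f i j $ \<tau> k = 0"
      using T_outer[of "axis i 1" k i' "\<tau> k"] T_outer[of "axis i 1" j i "\<tau> k"] \<tau>
      by (simp add: X[symmetric] T_pair i' ax)
    then have "X $ f i j $ m * A $ m $ \<tau> k = 0" for m
      using row zsf by (metis (no_types, lifting) UNIV_I finite sum_eq_0_imp_eq_0)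
    then have "X $ f i j $ m = 0" for m using full by (auto simp: semifield_mult_eq_0)
    then have "(X ** A) $ f i j $ \<tau> j = 0" by (simp add: row)
    then show False
      using T_outer[of "axis i 1" k i' "\<tau> j"] T_outer[of "axis i 1" j i "\<tau> j"] \<tau> c0
      by (simp add: X[symmetric] T_pair i' ax)
  qed
  define \<rho> where "\<rho> i = f i z" for i
  have f: "f i j = \<rho> i" for i j using f_row by (simp add: \<rho>_def)
  \<comment> \<open>Row \<open>\<rho> i\<close> of the image of e_i (e_j + e_l)^T is x times row
    \<open>\<rho> k\<close> of the image of e_k (e_j + e_l)^T, where x is one entry of X. So c_ij =
    x c_kj and c_il = x c_kl, and x can be eliminated.\<close>
  have rank1: "c i j * c k l = c i l * c k j" for i j k l
  proof (cases "j = l")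
    case False
    then have \<tau>: "\<tau> j \<noteq> \<tau> l" using inj_\<tau> by blast
    obtain X where X: "T (outer (axis i 1) (axis j 1 + axis l 1)) = X ** T (outer (axis k 1) (axis j 1 + axis l 1))"
      using pair_L[of "axis i 1" "axis k 1" j l] by auto
    have "T (outer (axis i 1) (axis j 1 + axis l 1)) $ \<rho> i $ q
       = (\<Sum>m\<in>UNIV. X $ \<rho> i $ m * (T (matrix_unit k j) $ m $ q + T (matrix_unit k l) $ m $ q))" for q
      unfolding X by (simp add: matrix_matrix_mult_def T_pair)
    then have "T (matrix_unit i j) $ \<rho> i $ q + T (matrix_unit i l) $ \<rho> i $ q
       = (\<Sum>m\<in>UNIV. X $ \<rho> i $ m * (T (matrix_unit k j) $ m $ q + T (matrix_unit k l) $ m $ q))" for q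
      by (simp add: T_pair)
    from this[of "\<tau> j"] this[of "\<tau> l"]
    have "c i j = (\<Sum>m\<in>UNIV. X $ \<rho> i $ m * (if m = \<rho> k then c k j else 0))"
      "c i l = (\<Sum>m\<in>UNIV. X $ \<rho> i $ m * (if m = \<rho> k then c k l else 0))"
      using \<tau> \<tau>[symmetric] by (simp_all add: Tu_nth f g)
    then have "c i j = X $ \<rho> i $ \<rho> k * c k j" "c i l = X $ \<rho> i $ \<rho> k * c k l"
      by (simp_all add: if_distrib cong: if_cong)
    then show ?thesis by (simp add: ac_simps)
  qed simp
  \<comment> \<open>Rank one gives c_ij = c_iz (c_zj e) with e the inverse of c_zz: the first factor
    goes into P, the second into Q.\<close>
  obtain e where e: "c z z * e = 1" using c0 ex_mult_inverse by blast
  define P :: "'a^'n^'n" where "P = (\<chi> r i. axis (\<rho> i) (c i z) $ r)"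
  define Q :: "'a^'n^'n" where "Q = (\<chi> j. axis (\<tau> j) (c z j * e))"
  have P: "P *v axis i 1 = axis (\<rho> i) (c i z)" for i
    by (simp add: matrix_vector_mult_axis vec_eq_iff P_def column_def)
  have Q: "axis j 1 v* Q = axis (\<tau> j) (c z j * e)" for j
    by (simp add: axis_vector_matrix_mult vec_eq_iff Q_def row_def)
  have "T (matrix_unit i j) = P ** matrix_unit i j ** Q" for i j
  proof -
    have "c i j = c i z * (c z j * e)"
      using rank1[of i j z z] e by (metis mult.assoc mult.comm_neutral)
    then show ?thesis
      unfolding matrix_mult_outer outer_matrix_mult P Q Tu f g
      by (auto simp: vec_eq_iff matrix_scale_def axis_def)
  qed
  then have "T A = P ** A ** Q" for A
    by (rule matrix_linear_eqI[OF lin matrix_linear_mult])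
  then show ?thesis by blast
qed

subsection \<open>Fields\<close>

text \<open>Lets \<open>matrix_linear\<close>, \<open>green_L\<close> and the results above apply
  verbatim to matrices over a field.\<close>

instance field \<subseteq> semifield
proof
  show "\<exists>b. a * b = 1" if "a \<noteq> 0" for a :: 'a
    using that by (intro exI[of _ "inverse a"]) simp
qed

text \<open>Extend x, y to a basis and index it so that x gets position a and y gets position d; a
  matrix whose rows form a basis is nonsingular.\<close>

lemma exists_two_rows:
  fixes x y :: "'a::field^'n"
  assumes "y \<noteq> 0" and indep: "\<And>t. x \<noteq> t *s y" and "a \<noteq> d"
  obtains c where "c a = x" "c d = y" "det (\<chi> j. c j) \<noteq> 0"
proof -
  have "x \<noteq> y" using indep[of 1] by simp
  have "x \<notin> vec.span {y}" using indep by (auto simp: vec.span_singleton)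
  then have ind: "vec.independent {x, y}"
    using \<open>y \<noteq> 0\<close> by (simp add: vec.independent_insert)
  define B where "B = vec.extend_basis {x, y}"
  have B: "{x, y} \<subseteq> B" "vec.independent B" "vec.span B = UNIV"
    using vec.extend_basis_superset[OF ind] vec.independent_extend_basis[OF ind]
      vec.span_extend_basis[OF ind] by (simp_all add: B_def)
  have fin: "finite B" using B(2) by (rule vec.finiteI_independent)
  have "card B = CARD('n)"
    using vec.basis_card_eq_dim[of B UNIV] B by (simp add: vec.dim_UNIV vec.dimension_def card_cart_basis)
  then have "card (UNIV - {a, d}) = card (B - {x, y})"
    using \<open>a \<noteq> d\<close> \<open>x \<noteq> y\<close> B(1) fin by (simp add: card_Diff_subset)
  then obtain h where h: "bij_betw h (UNIV - {a, d}) (B - {x, y})"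
    using fin finite_same_card_bij[of "UNIV - {a, d}" "B - {x, y}"] by auto
  define c where "c = h(a := x, d := y)"
  have "range c = c ` (UNIV - {a, d}) \<union> {c a, c d}" by auto
  also have "c ` (UNIV - {a, d}) = h ` (UNIV - {a, d})"
    by (intro image_cong) (auto simp: c_def)
  also have "\<dots> = B - {x, y}" using h by (simp add: bij_betw_def)
  finally have "range c = B" using B(1) \<open>a \<noteq> d\<close> by (auto simp: c_def)
  moreover have "rows (\<chi> j. c j) = range c" by (auto simp: rows_def row_def vec_lambda_eta)
  ultimately have "det (\<chi> j. c j) \<noteq> 0"
    using B(3)
    unfolding invertible_det_nz[symmetric] invertible_left_inverse matrix_left_invertible_span_rows_gen
    by simp
  then show thesis using that[of c] \<open>a \<noteq> d\<close> by (simp add: c_def)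
qed

lemma outer_mult_vec: "outer u v *v l = (\<Sum>i\<in>UNIV. v $ i * l $ i) *s (u :: 'a::comm_semiring_1^'n)"
  by (simp add: vec_eq_iff matrix_vector_mult_def sum_distrib_left ac_simps)

text \<open>Independence gives a nonzero 2x2 minor of x and y, in coordinates p, q. The functional z
  -> y_p z_q - y_q z_p vanishes at y and takes the value of this minor at x.\<close>

lemma exists_separating_functional:
  fixes x y :: "'a::field^'n"
  assumes "y \<noteq> 0" and indep: "\<And>t. x \<noteq> t *s y"
  obtains v where "(\<Sum>i\<in>UNIV. v $ i * x $ i) = 1" "(\<Sum>i\<in>UNIV. v $ i * y $ i) = 0"
proof -
  obtain p where p: "y $ p \<noteq> 0" using \<open>y \<noteq> 0\<close> by (auto simp: vec_eq_iff)
  \<comment> \<open>The multiple of y that agrees with x at p must differ from x at some other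
    coordinate q.\<close>
  obtain q where "x $ q \<noteq> ((x $ p / y $ p) *s y) $ q" using indep by (metis vec_eq_iff)
  then have q: "x $ q * y $ p - x $ p * y $ q \<noteq> 0" using p by (auto simp: field_simps)
  define v where "v = inverse (x $ q * y $ p - x $ p * y $ q) *s (axis q (y $ p) - axis p (y $ q))"
  have "(\<Sum>i\<in>UNIV. v $ i * z $ i)
      = inverse (x $ q * y $ p - x $ p * y $ q) * (y $ p * z $ q - y $ q * z $ p)" for z
    by (simp add: v_def mult.assoc left_diff_distrib right_diff_distrib sum_subtractf sum_axis_mult flip: sum_distrib_left)
  from this[of x] this[of y] show thesis
    using q by (intro that[of v]) (simp_all add: field_simps)
qed

text \<open>Models A -> T(A) w. By \<open>ker\<close>, whether \<open>\<phi>\<close> kills u v^T for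
  nonzero u depends on v alone, so u -> \<open>\<phi>\<close>(u v^T) is zero or injective. With G_b
  u = \<open>\<phi>\<close>(u e_b^T) and G = G_a injective, an eigenvector of G^{-1} G_b makes a
  combination of G_b and G non-injective, hence zero. The scalars relating the G_b to G form
  l.\<close>

lemma vector_functional_column_form:
  fixes \<phi> :: "'a::field^'n^'n \<Rightarrow> 'a^'n"
  assumes add: "\<And>A B. \<phi> (A + B) = \<phi> A + \<phi> B"
    and scale: "\<And>s A. \<phi> (matrix_scale s A) = s *s \<phi> A"
    and nz: "\<And>A. invertible A \<Longrightarrow> \<phi> A \<noteq> 0"
    and ker: "\<And>u u' v. u \<noteq> 0 \<Longrightarrow> \<phi> (outer u v) = 0 \<Longrightarrow> \<phi> (outer u' v) = 0"
  shows "\<exists>P l. \<forall>A. \<phi> A = P *v (A *v l)"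
proof -
  have zero: "\<phi> 0 = 0" using scale[of 0 0] by simp
  have sum: "\<phi> (sum f I) = (\<Sum>i\<in>I. \<phi> (f i))" for f and I :: "'n set"
    by (induction I rule: infinite_finite_induct) (simp_all add: zero add)
  have cols: "\<phi> A = (\<Sum>j\<in>UNIV. \<phi> (outer (column j A) (axis j 1)))" for A
    by (subst matrix_sum_columns[of A]) (simp add: sum)
  obtain a u0 where a: "\<phi> (outer u0 (axis a 1)) \<noteq> 0"
  proof (rule ccontr)
    assume "\<not> thesis"
    then have "\<phi> (outer u (axis j 1)) = 0" for u j using that by blast
    then have "\<phi> (mat 1) = 0" by (subst cols) simp
    then show False using nz[of "mat 1"] by (auto simp: invertible_def)
  qed
  have lin: "Vector_Spaces.linear (*s) (*s) (\<lambda>u. \<phi> (outer u v))" for v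
    by unfold_locales (simp_all add: outer_add_left outer_scale_left add scale)
  define G where "G = matrix (\<lambda>u. \<phi> (outer u (axis a 1)))"
  have G: "G *v u = \<phi> (outer u (axis a 1))" for u
    unfolding G_def by (rule matrix_works[OF lin])
  have "u = 0" if "G *v u = 0" for u using ker a that unfolding G by blast
  then have "\<exists>K. K ** G = mat 1" unfolding matrix_left_invertible_ker by simp
  then obtain K where KG: "K ** G = mat 1" ..
  then have GK: "G ** K = mat 1" by (rule matrix_left_right_inverse1)
  have GK_vec: "G *v (K *v z) = z" for z
    by (simp add: matrix_vector_mul_assoc GK)
  \<comment> \<open>H_i is -G^{-1} G_i. With this sign, putting the sum of the H_i(c_i) into column
    a cancels the contributions of all other columns.\<close>
  define H where "H i u = - (K *v \<phi> (outer u (axis i 1)))" for i u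
  have H_add: "H i (u + u') = H i u + H i u'" for i u u'
    by (simp add: H_def outer_add_left add matrix_vector_right_distrib)
  define D where "D c = det (\<chi> j. c j)" for c :: "'n \<Rightarrow> 'a^'n"
  define S where "S c = (\<Sum>i\<in>UNIV - {a}. H i (c i))" for c
  text \<open>Column \<open>a\<close> is chosen so that \<open>\<phi>\<close> annihilates the matrix with columns \<open>c(a := S c)\<close>.\<close>
  have D_S: "D (c(a := S c)) = 0" for c
  proof (rule ccontr)
    assume "D (c(a := S c)) \<noteq> 0"
    define B where "B = transpose (\<chi> j. (c(a := S c)) j)"
    have "invertible B"
      using \<open>D (c(a := S c)) \<noteq> 0\<close> by (simp add: invertible_det_nz B_def D_def del: fun_upd_apply)
    have col: "column j B = (c(a := S c)) j" for j
      by (simp add: B_def column_transpose row_def vec_lambda_eta)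
    have "\<phi> B = \<phi> (outer (S c) (axis a 1)) + (\<Sum>j\<in>UNIV - {a}. \<phi> (outer (c j) (axis j 1)))"
      by (subst cols, subst sum.remove[of _ a]) (simp_all add: col)
    also have "\<phi> (outer (S c) (axis a 1)) = (\<Sum>j\<in>UNIV - {a}. G *v H j (c j))"
      unfolding G[symmetric] S_def by (rule vec.linear_sum[OF matrix_vector_mul_linear_gen])
    also have "\<dots> = (\<Sum>j\<in>UNIV - {a}. - \<phi> (outer (c j) (axis j 1)))"
      by (simp add: H_def GK_vec vec.linear_neg[OF matrix_vector_mul_linear_gen])
    finally have "\<phi> B = 0" by (simp add: sum_negf)
    then show False using nz \<open>invertible B\<close> by blast
  qed
  have "\<exists>t. \<forall>u. \<phi> (outer u (axis b 1)) = t *s (G *v u)" for b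
  proof (cases "b = a")
    case True
    then show ?thesis by (intro exI[of _ 1]) (simp add: G)
  next
    case False
    \<comment> \<open>Without an eigenvector, y and \<open>H b y\<close> are independent for every
      nonzero y, so they occur as rows of a nonsingular matrix, against the vanishing
      determinants.\<close>
    have "\<exists>y t. y \<noteq> 0 \<and> H b y = t *s y"
    proof (rule ccontr)
      assume "\<nexists>y t. y \<noteq> 0 \<and> H b y = t *s y"
      then have no_eigen: "H b y \<noteq> t *s y" if "y \<noteq> 0" for y t using that by blast
      define y :: "'a^'n" where "y = axis a 1"
      have "y \<noteq> 0" by (simp add: y_def)
      show False
      proof (cases "\<exists>d. d \<noteq> a \<and> d \<noteq> b")
        case True
        then obtain d where d: "d \<noteq> a" "d \<noteq> b" by blast
        text \<open>Adding column \<open>d\<close> to column \<open>b\<close> changes column \<open>a\<close> by \<open>H b (c d)\<close>, so this vector is isolated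
          by comparing the two vanishing determinants.\<close>
        have D_H: "D (c(a := H b (c d))) = 0" for c
        proof -
          define c' where "c' = c(b := c b + c d)"
          define M :: "'a^'n^'n" where "M = (\<chi> j. (c(a := S c')) j)"
          have "S c' = H b (c' b) + (\<Sum>i\<in>UNIV - {a} - {b}. H i (c' i))"
            unfolding S_def using \<open>b \<noteq> a\<close> by (subst sum.remove[of _ b]) auto
          also have "(\<Sum>i\<in>UNIV - {a} - {b}. H i (c' i)) = (\<Sum>i\<in>UNIV - {a} - {b}. H i (c i))"
            by (intro sum.cong) (auto simp: c'_def)
          also have "H b (c' b) + \<dots> = H b (c d) + (H b (c b) + \<dots>)"
            by (simp add: c'_def H_add)
          also have "H b (c b) + (\<Sum>i\<in>UNIV - {a} - {b}. H i (c i)) = S c"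
            unfolding S_def using \<open>b \<noteq> a\<close> by (subst sum.remove[of _ b]) auto
          finally have S_c': "S c' = H b (c d) + S c" .
          have "det M = det (\<chi> k. if k = b then row b M + 1 *s row d M else row k M)"
            using det_row_operation[of b d M 1] d by simp
          also have "\<dots> = D (c'(a := S c'))"
            unfolding D_def using d \<open>b \<noteq> a\<close>
            by (intro arg_cong[where f = det]) (auto simp: vec_eq_iff M_def row_def c'_def)
          also have "\<dots> = 0" by (rule D_S)
          finally have "det M = 0" .
          moreover have "M = (\<chi> j. if j = a then H b (c d) + S c else c j)"
            by (simp add: M_def vec_eq_iff S_c')
          moreover have "D (c(a := v)) = det (\<chi> j. if j = a then v else c j)" for v
            unfolding D_def by (intro arg_cong[where f = det]) (auto simp: vec_eq_iff)
          ultimately show ?thesis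
            using det_row_add[of a "\<lambda>_. H b (c d)" "\<lambda>_. S c" c] D_S[of c] by simp
        qed
        obtain c where c: "c a = H b y" "c d = y" "D c \<noteq> 0"
          using exists_two_rows[OF \<open>y \<noteq> 0\<close> no_eigen[OF \<open>y \<noteq> 0\<close>] d(1)[symmetric]]
          unfolding D_def by blast
        then have "c(a := H b (c d)) = c" by auto
        then show False using D_H[of c] c(3) by simp
      next
        case False
        \<comment> \<open>With a and b the only indices, \<open>S c\<close> is already the isolated
          vector \<open>H b (c b)\<close>.\<close>
        then have "UNIV - {a} = {b}" using \<open>b \<noteq> a\<close> by auto
        then have S: "S c = H b (c b)" for c by (simp add: S_def)
        obtain c where c: "c a = H b y" "c b = y" "D c \<noteq> 0"
          using exists_two_rows[OF \<open>y \<noteq> 0\<close> no_eigen[OF \<open>y \<noteq> 0\<close>] \<open>b \<noteq> a\<close>[symmetric]]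
          unfolding D_def by blast
        then have "c(a := S c) = c" by (auto simp: S)
        then show False using D_S[of c] c(3) by simp
      qed
    qed
    then obtain y t where y: "y \<noteq> 0" "H b y = t *s y" by blast
    have "K *v \<phi> (outer y (axis b 1)) = (- t) *s y"
      using y(2) by (simp add: H_def vec_eq_iff) (metis minus_minus)
    then have "\<phi> (outer y (axis b 1)) = G *v ((- t) *s y)" using GK_vec by metis
    then have "\<phi> (outer y (axis b 1)) = (- t) *s (G *v y)" 
      by (simp only: vec.linear_scale[OF matrix_vector_mul_linear_gen])
    \<comment> \<open>The eigenvector relation is a vanishing on one u v^T with v = e_b + t e_a;
      \<open>ker\<close> then spreads it from y to every u.\<close>
    then have "\<phi> (outer y (axis b 1 + t *s axis a 1)) = 0"
      by (simp add: outer_add_right outer_scale_right add scale G vec_eq_iff)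
    then have "\<phi> (outer u (axis b 1 + t *s axis a 1)) = 0" for u using ker y(1) by blast
    then have "\<phi> (outer u (axis b 1)) = (- t) *s (G *v u)" for u
      by (simp add: outer_add_right outer_scale_right add scale G vec_eq_iff eq_neg_iff_add_eq_0)
    then show ?thesis by blast
  qed
  then obtain t where t: "\<And>b u. \<phi> (outer u (axis b 1)) = t b *s (G *v u)" by metis
  have "\<phi> A = G *v (A *v (\<chi> b. t b))" for A
  proof -
    have "\<phi> A = (\<Sum>b\<in>UNIV. G *v (t b *s column b A))"
      by (subst cols) (simp add: t vec.linear_scale[OF matrix_vector_mul_linear_gen])
    also have "\<dots> = G *v (\<Sum>b\<in>UNIV. t b *s column b A)"
      by (rule vec.linear_sum[OF matrix_vector_mul_linear_gen, symmetric])
    also have "(\<Sum>b\<in>UNIV. t b *s column b A) = A *v (\<chi> b. t b)"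
      by (simp add: matrix_mult_sum)
    finally show ?thesis .
  qed
  then show ?thesis by blast
qed

text \<open>For nonzero u' there is X with T(u' v^T) = X T(u v^T), so a vector killed by T(u v^T)
  stays killed. Supplies the hypothesis \<open>ker\<close> of
  \<open>vector_functional_column_form\<close>.\<close>

lemma matrix_linear_outer_0:
  assumes lin: "matrix_linear T" and pres: "preserves T green_L"
    and u: "u \<noteq> 0" "T (outer u v) *v w = 0"
  shows "T (outer u' v) *v w = 0"
proof (cases "u' = 0")
  case True
  then have "outer u' v = 0" by (simp add: vec_eq_iff)
  then show ?thesis by (simp add: matrix_linear_0[OF lin])
next
  case False
  then obtain X where "T (outer u' v) = X ** T (outer u v)"
    using preserves_green_L[OF pres green_L_outer[OF False u(1)]] by blast
  then show ?thesis by (simp add: u(2) flip: matrix_vector_mul_assoc)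
qed

text \<open>The invertible matrices are all \<open>green_L\<close>-related, so vanishing at one of
  them gives T(B) w = 0 for every invertible B. Differences of invertible matrices include units
  E_ij with i and j distinct, from which the vanishing spreads to whole columns and thus to all B,
  against surjectivity.\<close>

lemma preserver_invertible_inj:
  fixes T :: "'a::field^'n^'n \<Rightarrow> 'a^'n^'n"
  assumes "surj T" and lin: "matrix_linear T" and pres: "preserves T green_L"
    and "w \<noteq> 0" and A: "invertible A"
  shows "T A *v w \<noteq> 0"
proof
  assume 0: "T A *v w = 0"
  have inv0: "T B *v w = 0" if B: "invertible B" for B
  proof -
    have "leq_L C D" if "invertible D" for C D :: "'a^'n^'n"
    proof -
      obtain E where "E ** D = mat 1" using \<open>invertible D\<close> by (auto simp: invertible_def)
      then have "C = (C ** E) ** D" by (simp flip: matrix_mul_assoc)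
      then show ?thesis unfolding leq_L_def by blast
    qed
    then have "green_L B A" using A B by (simp add: green_L_def)
    then obtain X where "T B = X ** T A" using preserves_green_L[OF pres] by blast
    then show ?thesis by (simp add: 0 flip: matrix_vector_mul_assoc)
  qed
  have "T (outer u (axis j 1)) *v w = 0" for u j
  proof (cases "\<exists>i. i \<noteq> j")
    case True
    then obtain i where "i \<noteq> j" by blast
    let ?U = "matrix_unit i j :: 'a^'n^'n"
    \<comment> \<open>\<open>mat 1 + ?U\<close> is a transvection, hence invertible.\<close>
    have "x = 0" if x: "(mat 1 + ?U) *v x = 0" for x
    proof -
      have "x + x $ j *s axis i 1 = 0"
        using x by (simp add: matrix_vector_mult_add_rdistrib outer_mult_vec sum_axis_mult)
      moreover from this have "(x + x $ j *s axis i 1) $ j = 0" by simp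
      then have "x $ j = 0" using \<open>i \<noteq> j\<close> by (simp add: axis_def)
      ultimately show ?thesis by simp
    qed
    then have "invertible (mat 1 + ?U)"
      unfolding invertible_left_inverse matrix_left_invertible_ker by blast
    then have "T (mat 1) *v w + T ?U *v w = 0"
      using inv0[of "mat 1 + ?U"] by (simp add: matrix_linear_add[OF lin] matrix_vector_mult_add_rdistrib)
    moreover have "T (mat 1) *v w = 0" by (rule inv0) (auto simp: invertible_def)
    ultimately have "T ?U *v w = 0" by simp
    then show ?thesis
      using matrix_linear_outer_0[OF lin pres, of "axis i 1"] by simp
  next
    case False
    then have all: "i = j" for i by blast
    \<comment> \<open>For n = 1 the identity is itself the only matrix unit.\<close>
    have "mat 1 $ r $ s = (matrix_unit j j :: 'a^'n^'n) $ r $ s" for r s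
      using all[of r] all[of s] by (simp add: mat_def)
    then have "mat 1 = (matrix_unit j j :: 'a^'n^'n)" by (simp add: vec_eq_iff)
    moreover have "T (mat 1) *v w = 0" by (rule inv0) (auto simp: invertible_def)
    ultimately show ?thesis
      using matrix_linear_outer_0[OF lin pres, of "axis j 1"] by simp
  qed
  then have "T B *v w = 0" for B
  proof -
    have "T B *v w = (\<Sum>j\<in>UNIV. T (outer (column j B) (axis j 1))) *v w"
      by (subst matrix_sum_columns[of B]) (simp add: matrix_linear_sum[OF lin])
    also have "\<dots> = (\<Sum>j\<in>UNIV. T (outer (column j B) (axis j 1)) *v w)"
    proof -
      have "sum F I *v w = (\<Sum>j\<in>I. F j *v w)" for F :: "'n \<Rightarrow> 'a^'n^'n" and I
        by (induction I rule: infinite_finite_induct) (simp_all add: matrix_vector_mult_add_rdistrib)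
      then show ?thesis .
    qed
    finally show ?thesis by (simp add: \<open>\<And>u j. T (outer u (axis j 1)) *v w = 0\<close>)
  qed
  moreover obtain B where "T B = mat 1" using \<open>surj T\<close> by (metis surjD)
  ultimately have "w = 0" by (metis matrix_vector_mul_lid)
  then show False using \<open>w \<noteq> 0\<close> by simp
qed

text \<open>For n = 1 every matrix is a scalar multiple of \<open>mat 1\<close>. The case is split
  off because \<open>field_preserver\<close> works with two distinct indices.\<close>

lemma linear_map_one_by_one:
  fixes T :: "'a::semifield^'n^'n \<Rightarrow> 'a^'n^'n"
  assumes "matrix_linear T" and one: "\<And>i j :: 'n. i = j"
  shows "T A = mat 1 ** A ** T (mat 1)"
proof -
  have A: "A = matrix_scale (A $ k $ k) (mat 1)" for k
    using one by (auto simp: vec_eq_iff matrix_scale_def mat_def) metis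
  have "T A = matrix_scale (A $ k $ k) (mat 1 ** mat 1 ** T (mat 1))" for k
    using matrix_linear_scale[OF assms(1), of "A $ k $ k" "mat 1"] A[of k] by simp
  also have "\<dots> k = mat 1 ** matrix_scale (A $ k $ k) (mat 1) ** T (mat 1)" for k
    by (simp add: matrix_mult_scale_left)
  finally show ?thesis using A by metis
qed

text \<open>For each w there are P_w and l_w with T(A) w = P_w A l_w. Once all P_w with nonzero w
  are multiples of a single matrix, the scalars can be moved into l_w, and the vectors for w = e_j
  become the columns of Q.\<close>

lemma field_preserver:
  fixes T :: "'a::field^'n^'n \<Rightarrow> 'a^'n^'n"
  assumes bij: "bij T" and lin: "matrix_linear T" and pres: "preserves T green_L"
  shows "\<exists>P Q. \<forall>A. T A = P ** A ** Q"
proof (cases "\<forall>i j :: 'n. i = j")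
  case True
  then show ?thesis using linear_map_one_by_one[OF lin] by blast
next
  case False
  then obtain p q :: 'n where "p \<noteq> q" by blast
  have inj: "inj T" and surj: "surj T" using bij by (auto simp: bij_def)
  have "\<forall>w. \<exists>P l. \<forall>A. T A *v w = P *v (A *v l)"
  proof
    fix w :: "'a^'n"
    show "\<exists>P l. \<forall>A. T A *v w = P *v (A *v l)"
    proof (cases "w = 0")
      case True
      then show ?thesis by (intro exI[of _ 0]) simp
    next
      case False
      show ?thesis
      proof (rule vector_functional_column_form)
        show "T (A + B) *v w = T A *v w + T B *v w" for A B
          by (simp add: matrix_linear_add[OF lin] matrix_vector_mult_add_rdistrib)
        show "T (matrix_scale s A) *v w = s *s (T A *v w)" for s A
          by (simp add: matrix_linear_scale[OF lin] matrix_scale_mult_vec)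
        show "T A *v w \<noteq> 0" if "invertible A" for A
          by (rule preserver_invertible_inj[OF surj lin pres False that])
        show "T (outer u' v) *v w = 0" if "u \<noteq> 0" "T (outer u v) *v w = 0" for u u' v
          by (rule matrix_linear_outer_0[OF lin pres that])
      qed
    qed
  qed
  then obtain P l where Pl: "\<And>w A. T A *v w = P w *v (A *v l w)"
    unfolding choice_iff by blast
  have nz: "P w \<noteq> 0 \<and> l w \<noteq> 0" if "w \<noteq> 0" for w
  proof (rule ccontr)
    assume "\<not> (P w \<noteq> 0 \<and> l w \<noteq> 0)"
    then have "T (mat 1) *v w = 0" by (auto simp: Pl)
    then show False
      using preserver_invertible_inj[OF surj lin pres \<open>w \<noteq> 0\<close>, of "mat 1"]
      by (auto simp: invertible_def)
  qed
  have mat_scale: "P w1 = matrix_scale t (P w)"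
    if "\<And>u. P w1 *v u = t *s (P w *v u)" for t w1 w
    using that by (simp add: matrix_eq matrix_scale_mult_vec)
  \<comment> \<open>Evaluating u v^T at w3 = w1 + w2 gives (v.l3) P3 u = (v.l1) P1 u + (v.l2) P2 u.
    Choosing v with (v.l1, v.l2) equal to (1, 0) and to (0, 1) makes P1 and P2 multiples of
    P3.\<close>
  have parallel: "\<exists>t. P w1 = matrix_scale t (P w2)"
    if w: "w1 \<noteq> 0" "w2 \<noteq> 0" and indep: "\<And>t. l w1 \<noteq> t *s l w2" for w1 w2
  proof -
    have indep': "l w2 \<noteq> t *s l w1" for t
    proof
      assume "l w2 = t *s l w1"
      moreover from this have "t \<noteq> 0" using nz[OF w(2)] by auto
      ultimately have "l w1 = inverse t *s l w2" by simp
      then show False using indep by blast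
    qed
    define w3 where "w3 = w1 + w2"
    have eq: "(\<Sum>i\<in>UNIV. v $ i * l w3 $ i) *s (P w3 *v u)
        = (\<Sum>i\<in>UNIV. v $ i * l w1 $ i) *s (P w1 *v u) + (\<Sum>i\<in>UNIV. v $ i * l w2 $ i) *s (P w2 *v u)" for u v
    proof -
      have "T (outer u v) *v w3 = T (outer u v) *v w1 + T (outer u v) *v w2"
        by (simp add: w3_def matrix_vector_right_distrib)
      then show ?thesis
        by (simp only: Pl outer_mult_vec vec.linear_scale[OF matrix_vector_mul_linear_gen])
    qed
    obtain v1 where "(\<Sum>i\<in>UNIV. v1 $ i * l w1 $ i) = 1" "(\<Sum>i\<in>UNIV. v1 $ i * l w2 $ i) = 0"
      using exists_separating_functional[of "l w2" "l w1"] nz[OF w(2)] indep by blast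
    then have "P w1 *v u = (\<Sum>i\<in>UNIV. v1 $ i * l w3 $ i) *s (P w3 *v u)" for u
      using eq[of v1 u] by simp
    then obtain r1 where r1: "\<And>u. P w1 *v u = r1 *s (P w3 *v u)" by blast
    obtain v2 where "(\<Sum>i\<in>UNIV. v2 $ i * l w2 $ i) = 1" "(\<Sum>i\<in>UNIV. v2 $ i * l w1 $ i) = 0"
      using exists_separating_functional[of "l w1" "l w2"] nz[OF w(1)] indep' by blast
    then have "P w2 *v u = (\<Sum>i\<in>UNIV. v2 $ i * l w3 $ i) *s (P w3 *v u)" for u
      using eq[of v2 u] by simp
    then obtain r2 where r2: "\<And>u. P w2 *v u = r2 *s (P w3 *v u)" by blast
    have "r2 \<noteq> 0"
    proof
      assume "r2 = 0"
      then have "P w2 = 0" using r2 by (simp add: matrix_eq)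
      then show False using nz[OF w(2)] by simp
    qed
    then have "P w1 *v u = (r1 / r2) *s (P w2 *v u)" for u
      by (simp add: r1 r2)
    then show ?thesis using mat_scale by blast
  qed
  \<comment> \<open>If all l_w were parallel, a nonzero v' orthogonal to them would give T(e_p v'^T)
    w = 0 for every w, against injectivity of T.\<close>
  have "\<exists>w1 w2. w1 \<noteq> 0 \<and> w2 \<noteq> 0 \<and> (\<forall>t. l w1 \<noteq> t *s l w2)"
  proof (rule ccontr)
    assume no: "\<not> ?thesis"
    define w0 :: "'a^'n" where "w0 = axis p 1"
    have "w0 \<noteq> 0" by (simp add: w0_def)
    \<comment> \<open>v is orthogonal to \<open>l w0\<close> and supported on p and q. If it is 0,
      then \<open>l w0\<close> has a zero coordinate there and an axis vector serves
      instead.\<close>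
    define v where "v = l w0 $ q *s axis p 1 - l w0 $ p *s (axis q 1 :: 'a^'n)"
    obtain v' :: "'a^'n" where v': "v' \<noteq> 0" "(\<Sum>i\<in>UNIV. v' $ i * l w0 $ i) = 0"
    proof (cases "v = 0")
      case False
      have "(\<Sum>i\<in>UNIV. v $ i * l w0 $ i) = 0"
        by (simp add: v_def left_diff_distrib sum_subtractf mult.assoc sum_axis_mult flip: sum_distrib_left)
      then show ?thesis using that False by blast
    next
      case True
      then have "v $ p = 0" by simp
      then have "l w0 $ p = 0 \<or> l w0 $ q = 0" using \<open>p \<noteq> q\<close> by (simp add: v_def axis_def)
      then show ?thesis
        using that[of "axis p 1"] that[of "axis q 1"] by (auto simp: sum_axis_mult)
    qed
    let ?A = "outer (axis p 1) v'"
    have "T ?A *v w = 0" for w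
    proof (cases "w = 0")
      case False
      then obtain t where "l w = t *s l w0" using no \<open>w0 \<noteq> 0\<close> by blast
      then have "?A *v l w = 0"
        using v'(2) by (simp add: outer_mult_vec mult.left_commute flip: sum_distrib_left)
      then show ?thesis by (simp add: Pl)
    qed simp
    then have "T ?A = T 0" by (simp add: matrix_eq matrix_linear_0[OF lin])
    then have "?A = 0" using inj by (simp add: inj_eq)
    then have "?A $ p $ j = 0" for j by simp
    then have "v' = 0" by (simp add: vec_eq_iff)
    then show False using v'(1) by simp
  qed
  then obtain w1 w2 where w: "w1 \<noteq> 0" "w2 \<noteq> 0" and indep: "\<And>t. l w1 \<noteq> t *s l w2" by blast
  \<comment> \<open>If \<open>l w\<close> is parallel to \<open>l w2\<close>, the comparison goes
    through w1, whose \<open>l w1\<close> is independent of both.\<close>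
  have P_parallel: "\<exists>t. P w = matrix_scale t (P w2)" if wnz: "w \<noteq> 0" for w
  proof (cases "\<exists>t. l w = t *s l w2")
    case False
    then show ?thesis using parallel[OF wnz w(2)] by blast
  next
    case True
    then obtain t where t: "l w = t *s l w2" by blast
    then have "t \<noteq> 0" using nz[OF wnz] by auto
    have "l w1 \<noteq> s *s l w" for s
      using indep[of "s * t"] by (simp add: t vec_eq_iff mult.assoc)
    then obtain s where s: "P w1 = matrix_scale s (P w)" using parallel[OF w(1) wnz] by blast
    obtain r where r: "P w1 = matrix_scale r (P w2)" using parallel[OF w indep] by blast
    have "s \<noteq> 0" using s nz[OF w(1)] by auto
    then have "P w = matrix_scale (inverse s) (P w1)" by (simp add: s matrix_scale_scale)
    then show ?thesis by (auto simp: r matrix_scale_scale)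
  qed
  have "\<forall>j. \<exists>v. \<forall>A. T A *v axis j 1 = P w2 *v (A *v v)"
  proof
    fix j
    have "axis j 1 \<noteq> (0 :: 'a^'n)" by simp
    then obtain t where t: "P (axis j 1) = matrix_scale t (P w2)" using P_parallel by blast
    have "T A *v axis j 1 = P w2 *v (A *v (t *s l (axis j 1)))" for A
      by (simp only: Pl t matrix_scale_mult_vec vec.linear_scale[OF matrix_vector_mul_linear_gen])
    then show "\<exists>v. \<forall>A. T A *v axis j 1 = P w2 *v (A *v v)" by blast
  qed
  then obtain k where k: "\<And>j A. T A *v axis j 1 = P w2 *v (A *v k j)"
    unfolding choice_iff by blast
  define Q where "Q = (\<chi> i j. k j $ i)"
  have "T A = P w2 ** A ** Q" for A
  proof -
    have "Q *v axis j 1 = k j" for j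
      by (simp add: matrix_vector_mult_axis Q_def column_def vec_lambda_eta)
    then have "T A *v axis j 1 = (P w2 ** A ** Q) *v axis j 1" for j
      by (simp add: k flip: matrix_vector_mul_assoc)
    then show ?thesis by (simp add: matrix_vector_mult_axis vec_eq_iff column_def)
  qed
  then show ?thesis by blast
qed

subsection \<open>Semifields with additive inverses\<close>

text \<open>The linear algebra of the library is tied to the class \<open>field\<close>. The type below is an isomorphic
  copy of \<open>'a\<close> if \<open>'a\<close> has additive inverses; otherwise it is the two-element field, so that it is an
  instance of \<open>field\<close> unconditionally.\<close>

typedef (overloaded) 'a field_hull =
  "{x :: 'a::semifield. (\<exists>m :: 'a. 1 + m = 0) \<or> x = 0 \<or> x = 1}"
  by auto

setup_lifting type_definition_field_hull

text \<open>Any negative m of 1 yields x + m x = (1 + m) x = 0; the chosen m serves in the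
  definition of negation below.\<close>

lemma minus_one_add:
  fixes x :: "'a::comm_semiring_1"
  assumes "\<exists>m :: 'a. 1 + m = 0"
  shows "x + (SOME m. 1 + m = 0) * x = 0"
proof -
  have "1 + (SOME m :: 'a. 1 + m = 0) = 0" using assms by (rule someI_ex)
  then have "(1 + (SOME m :: 'a. 1 + m = 0)) * x = 0" by simp
  then show ?thesis by (simp only: distrib_right mult_1)
qed

instantiation field_hull :: (semifield) field
begin

lift_definition zero_field_hull :: "'a field_hull" is 0 by simp

lift_definition one_field_hull :: "'a field_hull" is 1 by simp

text \<open>In the fallback case this is addition modulo 2 on {0, 1}, where each element is its own
  negative.\<close>

lift_definition plus_field_hull :: "'a field_hull \<Rightarrow> 'a field_hull \<Rightarrow> 'a field_hull" is
  "\<lambda>x y. if \<exists>m :: 'a. 1 + m = 0 then x + y else if x = y then 0 else 1" by auto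

lift_definition times_field_hull :: "'a field_hull \<Rightarrow> 'a field_hull \<Rightarrow> 'a field_hull" is
  "\<lambda>x y. x * y" by auto

lift_definition uminus_field_hull :: "'a field_hull \<Rightarrow> 'a field_hull" is
  "\<lambda>x. if \<exists>m :: 'a. 1 + m = 0 then (SOME m. 1 + m = 0) * x else x" by auto

definition minus_field_hull :: "'a field_hull \<Rightarrow> 'a field_hull \<Rightarrow> 'a field_hull" where
  "minus_field_hull x y = x + - y"

definition inverse_field_hull :: "'a field_hull \<Rightarrow> 'a field_hull" where
  "inverse_field_hull x = (if x = 0 then 0 else SOME y. y * x = 1)"

definition divide_field_hull :: "'a field_hull \<Rightarrow> 'a field_hull \<Rightarrow> 'a field_hull" where
  "divide_field_hull x y = x * inverse y"

instance
proof
  fix x y z :: "'a field_hull"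
  show "x + y + z = x + (y + z)" by transfer (auto simp: add.assoc)
  show commute: "x + y = y + x" for x y :: "'a field_hull" by transfer (auto simp: add.commute)
  show "0 + x = x" by transfer auto
  show "x * y * z = x * (y * z)" by transfer (auto simp: mult.assoc)
  show "x * y = y * x" by transfer (auto simp: mult.commute)
  show "1 * x = x" by transfer auto
  show "(x + y) * z = x * z + y * z" by transfer (auto simp: distrib_right)
  show "(0 :: 'a field_hull) \<noteq> 1" by transfer simp
  have "x + - x = 0" by transfer (simp add: minus_one_add)
  then show "- x + x = 0" by (simp add: commute[of "- x"])
  show "x - y = x + - y" by (rule minus_field_hull_def)
  show "x div y = x * inverse y" by (rule divide_field_hull_def)
  show "inverse (0 :: 'a field_hull) = 0" by (simp add: inverse_field_hull_def)
  show "inverse x * x = 1" if "x \<noteq> 0"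
  proof -
    have "\<exists>y. y * x = 1"
    proof -
      have "Rep_field_hull x \<noteq> 0"
        using that Rep_field_hull_inject[of x 0] by (simp add: zero_field_hull.rep_eq)
      then obtain b where b: "Rep_field_hull x * b = 1" using ex_mult_inverse by blast
      \<comment> \<open>The inverse stays in the carrier: in the fallback case a nonzero x is 1, so
        b is 1 too.\<close>
      then have "b \<in> {x. (\<exists>m :: 'a. 1 + m = 0) \<or> x = 0 \<or> x = 1}"
        using Rep_field_hull[of x] \<open>Rep_field_hull x \<noteq> 0\<close> by auto
      then have "Abs_field_hull b * x = 1"
        using b by (simp add: times_field_hull.rep_eq one_field_hull.rep_eq Abs_field_hull_inverse
            mult.commute flip: Rep_field_hull_inject)
      then show ?thesis ..
    qed
    then show ?thesis using that someI_ex[of "\<lambda>y. y * x = 1"] by (simp add: inverse_field_hull_def)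
  qed
qed

end

lemma Rep_field_hull_hom:
  fixes x y :: "'a::semifield field_hull"
  assumes "\<exists>m :: 'a. 1 + m = 0"
  shows "bij (Rep_field_hull :: 'a field_hull \<Rightarrow> 'a)"
    and "Rep_field_hull (x + y) = Rep_field_hull x + Rep_field_hull y"
    and "Rep_field_hull (x * y) = Rep_field_hull x * Rep_field_hull y"
    and "Rep_field_hull (0 :: 'a field_hull) = 0"
proof -
  have "range (Rep_field_hull :: 'a field_hull \<Rightarrow> 'a) = UNIV"
    using assms type_definition.Rep_range[OF type_definition_field_hull] by auto
  then show "bij (Rep_field_hull :: 'a field_hull \<Rightarrow> 'a)"
    by (simp add: bij_def inj_def Rep_field_hull_inject)
qed (use assms in \<open>simp_all add: plus_field_hull.rep_eq times_field_hull.rep_eq zero_field_hull.rep_eq\<close>)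

section \<open>Transport along an isomorphism from a field\<close>

definition map_matrix :: "('a \<Rightarrow> 'b) \<Rightarrow> 'a^'n^'m \<Rightarrow> 'b^'n^'m" where
  "map_matrix f A = (\<chi> i j. f (A $ i $ j))"

lemma map_matrix_nth [simp]: "map_matrix f A $ i $ j = f (A $ i $ j)"
  by (simp add: map_matrix_def)

text \<open>Applying \<open>\<phi>\<close> entrywise respects sums, products and, up to
  \<open>\<phi>\<close> on scalars, scaling. Conjugating T by it gives a preserver over the field
  'b, and the factors found there are mapped back.\<close>

lemma preserver_transport:
  fixes \<phi> :: "'b::field \<Rightarrow> 'a::semifield" and T :: "'a^'n^'n \<Rightarrow> 'a^'n^'n"
  assumes bij\<phi>: "bij \<phi>" and add: "\<And>x y. \<phi> (x + y) = \<phi> x + \<phi> y"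
    and mult: "\<And>x y. \<phi> (x * y) = \<phi> x * \<phi> y" and zero: "\<phi> 0 = 0"
    and bij: "bij T" and lin: "matrix_linear T" and pres: "preserves T green_L"
  shows "\<exists>P Q. \<forall>A. T A = P ** A ** Q"
proof -
  define M :: "'b^'n^'n \<Rightarrow> 'a^'n^'n" where "M = map_matrix \<phi>"
  define N :: "'a^'n^'n \<Rightarrow> 'b^'n^'n" where "N = map_matrix (inv \<phi>)"
  have MN: "M (N A) = A" and NM: "N (M B) = B" for A B
    using bij\<phi> by (simp_all add: M_def N_def vec_eq_iff bij_def surj_f_inv_f)
  have M_inj: "M A = M B \<longleftrightarrow> A = B" for A B using NM by metis
  have M_add: "M (A + B) = M A + M B" for A B
    by (simp add: M_def vec_eq_iff add)
  have M_scale: "M (matrix_scale s A) = matrix_scale (\<phi> s) (M A)" for s A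
    by (simp add: M_def vec_eq_iff mult matrix_scale_def)
  have \<phi>_sum: "\<phi> (sum f I) = (\<Sum>i\<in>I. \<phi> (f i))" for f and I :: "'n set"
    by (induction I rule: infinite_finite_induct) (simp_all add: zero add)
  have M_mult: "M (A ** B) = M A ** M B" for A B
    by (simp add: M_def vec_eq_iff matrix_matrix_mult_def \<phi>_sum mult)
  have M_leq: "leq_L (M A) (M B) \<longleftrightarrow> leq_L A B" for A B
    unfolding leq_L_def by (metis MN M_inj M_mult)
  define T' where "T' B = N (T (M B))" for B
  have MT': "M (T' B) = T (M B)" for B by (simp add: T'_def MN)
  have "bij T'"
  proof (rule bijI')
    show "T' A = T' B \<longleftrightarrow> A = B" for A B
      using bij by (metis MT' M_inj bij_def inj_eq)
    show "\<exists>A. B = T' A" for B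
    proof -
      obtain A where "T A = M B" using bij by (metis bij_pointE)
      then have "B = T' (N A)" by (simp add: T'_def MN NM)
      then show ?thesis ..
    qed
  qed
  moreover have "matrix_linear T'"
    unfolding matrix_linear_def
  proof (intro conjI allI)
    show "T' (A + B) = T' A + T' B" for A B
      by (simp add: MT' M_add matrix_linear_add[OF lin] flip: M_inj)
    show "T' (matrix_scale s A) = matrix_scale s (T' A)" for s A
      by (simp add: MT' M_scale matrix_linear_scale[OF lin] flip: M_inj)
  qed
  moreover have "preserves T' green_L"
    using pres unfolding preserves_def green_L_def by (metis MT' M_leq)
  ultimately obtain P Q where "\<And>B. T' B = P ** B ** Q" using field_preserver by blast
  then have "T A = M P ** A ** M Q" for A
    using MT'[of "N A"] by (simp add: M_mult MN)
  then show ?thesis by blast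
qed

subsection \<open>The equivalence\<close>

text \<open>Either 1 has an additive inverse, and \<open>Rep_field_hull\<close> is an isomorphism
  from a field, or S is antinegative: if x + y = 0 with x c = 1, then 1 + y c = 0.\<close>

lemma preserves_green_L_imp_GL:
  fixes T :: "'a::semifield^'n^'n \<Rightarrow> 'a^'n^'n"
  assumes bij: "bij T" and lin: "matrix_linear T" and pres: "preserves T green_L"
  shows "\<exists>P\<in>GL. \<exists>Q\<in>GL. \<forall>A. T A = P ** A ** Q"
proof -
  have "\<exists>P Q. \<forall>A. T A = P ** A ** Q"
  proof (cases "\<exists>m :: 'a. 1 + m = 0")
    case True
    show ?thesis
      by (rule preserver_transport[OF Rep_field_hull_hom[OF True] bij lin pres])
  next
    case False
    have "x = 0" if "x + y = 0" for x y :: 'a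
    proof (rule ccontr)
      assume "x \<noteq> 0"
      then obtain c where "x * c = 1" using ex_mult_inverse by blast
      then have "1 + y * c = (x + y) * c" by (simp add: distrib_right)
      then show False using False that by simp
    qed
    then show ?thesis using antinegative_preserver[OF _ bij lin pres] by blast
  qed
  then show ?thesis using bij_mult_imp_GL[OF bij] by blast
qed

section \<open>Transposition and the relation \<open>green_R\<close>\<close>

lemma leq_R_transpose: "leq_R A B \<longleftrightarrow> leq_L (transpose A) (transpose B)"
  unfolding leq_R_def leq_L_def by (metis matrix_transpose_mul transpose_transpose)

lemma GL_transpose: "P \<in> GL \<Longrightarrow> transpose P \<in> GL"
  unfolding GL_def invertible_def by (auto simp: transpose_mat simp flip: matrix_transpose_mul)
    (metis matrix_transpose_mul transpose_mat)

text \<open>Conjugating T by transposition turns preservation of \<open>green_R\<close> into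
  preservation of \<open>green_L\<close>; transposing back swaps the two factors.\<close>

lemma preserves_green_R_imp_GL:
  fixes T :: "'a::semifield^'n^'n \<Rightarrow> 'a^'n^'n"
  assumes bij: "bij T" and lin: "matrix_linear T" and pres: "preserves T green_R"
  shows "\<exists>P\<in>GL. \<exists>Q\<in>GL. \<forall>A. T A = P ** A ** Q"
proof -
  define T' where "T' A = transpose (T (transpose A))" for A
  have tr: "bij (transpose :: 'a^'n^'n \<Rightarrow> 'a^'n^'n)"
    by (rule o_bij[where g = transpose]) (simp_all add: fun_eq_iff)
  have "T' = transpose \<circ> T \<circ> transpose" by (simp add: fun_eq_iff T'_def)
  then have "bij T'" using bij tr by (simp add: bij_comp)
  moreover have "matrix_linear T'"
  proof -
    have "transpose (A + B) = transpose A + transpose B"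
      "transpose (matrix_scale s A) = matrix_scale s (transpose A)" for A B :: "'a^'n^'n" and s
      by (simp_all add: vec_eq_iff transpose_def matrix_scale_def)
    then show ?thesis
      by (simp add: matrix_linear_def T'_def matrix_linear_add[OF lin] matrix_linear_scale[OF lin])
  qed
  moreover have "preserves T' green_L"
    using pres by (simp add: preserves_def green_L_def green_R_def T'_def leq_R_transpose)
  ultimately obtain P Q where PQ: "P \<in> GL" "Q \<in> GL" "\<And>A. T' A = P ** A ** Q"
    using preserves_green_L_imp_GL by blast
  have "T A = transpose Q ** A ** transpose P" for A
  proof -
    have "T A = transpose (T' (transpose A))" by (simp add: T'_def)
    also have "\<dots> = transpose Q ** A ** transpose P"
      unfolding PQ(3) by (simp add: matrix_transpose_mul matrix_mul_assoc)
    finally show ?thesis .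
  qed
  then show ?thesis using PQ(1,2) GL_transpose by blast
qed

text \<open>P (X B) Q = (P X P^{-1}) (P B Q) and P (B X) Q = (P B Q) (Q^{-1} X Q).\<close>

lemma GL_mult_preserves_leq:
  assumes "P \<in> GL" "Q \<in> GL" and T: "\<And>A. T A = P ** A ** Q"
  shows "preserves T leq_L" and "preserves T leq_R"
proof -
  obtain P' where P': "P' ** P = mat 1" using \<open>P \<in> GL\<close> by (auto simp: GL_def invertible_def)
  obtain Q' where Q': "Q ** Q' = mat 1" using \<open>Q \<in> GL\<close> by (auto simp: GL_def invertible_def)
  have "P ** (X ** B) ** Q = (P ** X ** P') ** (P ** B ** Q)" for X B
  proof -
    have "(P ** X ** P') ** (P ** B ** Q) = P ** X ** (P' ** P) ** B ** Q"
      by (simp only: matrix_mul_assoc)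
    then show ?thesis by (simp add: P' matrix_mul_assoc)
  qed
  then show "preserves T leq_L" unfolding preserves_def leq_L_def T by blast
  have "P ** (B ** X) ** Q = (P ** B ** Q) ** (Q' ** X ** Q)" for X B
  proof -
    have "(P ** B ** Q) ** (Q' ** X ** Q) = P ** B ** (Q ** Q') ** X ** Q"
      by (simp only: matrix_mul_assoc)
    then show ?thesis by (simp add: Q' matrix_mul_assoc)
  qed
  then show "preserves T leq_R" unfolding preserves_def leq_R_def T by blast
qed

theorem theorem3p4:
  fixes T :: "'a::semifield^'n^'n \<Rightarrow> 'a^'n^'n"
  assumes "bij T" and "matrix_linear T"
  shows "(preserves T green_L \<longleftrightarrow> preserves T green_R) \<and>
         (preserves T green_R \<longleftrightarrow> preserves T leq_L) \<and>
         (preserves T leq_L \<longleftrightarrow> preserves T leq_R) \<and>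
         (preserves T leq_R \<longleftrightarrow> (\<exists>P\<in>GL. \<exists>Q\<in>GL. \<forall>A. T A = P ** A ** Q))"
proof -
  let ?v = "\<exists>P\<in>GL. \<exists>Q\<in>GL. \<forall>A. T A = P ** A ** Q"
  \<comment> \<open>Each preorder yields its equivalence relation, each equivalence relation yields
    \<open>?v\<close>, and \<open>?v\<close> yields both preorders.\<close>
  have "preserves T green_L" if "preserves T leq_L"
    using that by (auto simp: preserves_def green_L_def)
  moreover have "preserves T green_R" if "preserves T leq_R"
    using that by (auto simp: preserves_def green_R_def)
  moreover have "preserves T leq_L \<and> preserves T leq_R" if ?v
    using that GL_mult_preserves_leq by blast
  moreover have ?v if "preserves T green_L"
    by (rule preserves_green_L_imp_GL[OF assms that])
  moreover have ?v if "preserves T green_R"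
    by (rule preserves_green_R_imp_GL[OF assms that])
  ultimately show ?thesis by argo
qed

end
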